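(* Let $G$ be a nonempty graph and let $d\geq 3$ be an integer. If the weak degeneracy of $G$ is at least $d$, then either $G$ contains a $(d+1)$-clique or \[ \mathrm{mad}(G)\,\geq\, d+\frac{d-2}{d^2+2d-2}. \]
   Context: All graphs are finite and simple; $\mathbb{N}=\{0,1,2,\ldots\}$. A $(d+1)$-clique is a set of $d+1$ pairwise adjacent vertices. The average degree of a nonempty graph $H$ is $\mathrm{ad}(H)=2|E(H)|/|V(H)|$. The maximum average degree of a nonempty graph $G$ is $\mathrm{mad}(G)=\max_H \mathrm{ad}(H)$, the maximum being over all nonempty subgraphs $H$ of $G$. Weak degeneracy: let $G$ be a graph and $f\colon V(G)\to\mathbb{N}$. For a vertex $u$, the operation $\mathrm{Delete}(G,f,u)$ outputs $G'=G-u$ and $f'\colon V(G')\to\mathbb{Z}$ with $f'(v)=f(v)-1$ if $uv\in E(G)$ and $f'(v)=f(v)$ otherwise; its application is legal if $f'(v)\geq 0$ for all $v\in V(G')$. For adjacent vertices $u,w$, the operation $\mathrm{DelSave}(G,f,u,w)$ outputs $G'=G-u$ and $f'\colon V(G')\to\mathbb{Z}$ with $f'(v)=f(v)-1$ if $uv\in E(G)$ and $v\neq w$, and $f'(v)=f(v)$ otherwise; its application is legal if $f(u)>f(w)$ and $f'$ is non-negative. $G$ is weakly $f$-degenerate if all vertices of $G$ can be removed by a sequence of legal applications of Delete and DelSave, starting with $(G,f)$. For $d\in\mathbb{N}$, $G$ is weakly $d$-degenerate if it is weakly degenerate with respect to the constant $d$ function. The weak degeneracy of $G$ is the minimum $d$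 such that $G$ is weakly $d$-degenerate. *)

theory Defs
  imports Complex_Main
begin

locale fin_sgraph =
  fixes V :: "'a set" and E :: "'a set set"
  assumes finite_verts: "finite V"
    and edge_subset: "e \<in> E \<Longrightarrow> e \<subseteq> V"
    and edge_card: "e \<in> E \<Longrightarrow> card e = 2"

definition subgraph :: "'a set \<Rightarrow> 'a set set \<Rightarrow> 'a set \<Rightarrow> 'a set set \<Rightarrow> bool" where
  "subgraph W F V E \<longleftrightarrow> fin_sgraph W F \<and> W \<subseteq> V \<and> F \<subseteq> E"

definition clique :: "'a set \<Rightarrow> 'a set set \<Rightarrow> 'a set \<Rightarrow> bool" where
  "clique V E K \<longleftrightarrow> K \<subseteq> V \<and> (\<forall>x\<in>K. \<forall>y\<in>K. x \<noteq> y \<longrightarrow> {x, y} \<in> E)"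


subsection \<open>Maximum average degree\<close>

definition avg_degree :: "'a set \<Rightarrow> 'a set set \<Rightarrow> real" where
  "avg_degree V E = 2 * real (card E) / real (card V)"

definition mad :: "'a set \<Rightarrow> 'a set set \<Rightarrow> real" where
  "mad V E = Max {avg_degree W F | W F. subgraph W F V E \<and> W \<noteq> {}}"

text \<open>For a nonempty finite graph the maximum ranges over a finite nonempty set, so
  \<^const>\<open>Max\<close> is a genuine maximum.\<close>

lemma (in fin_sgraph) finite_edges: "finite E"
  using finite_verts edge_subset by (meson PowI finite_Pow_iff finite_subset subsetI)

lemma (in fin_sgraph) mad_well_defined:
  assumes "V \<noteq> {}"
  shows "finite {avg_degree W F | W F. subgraph W F V E \<and> W \<noteq> {}}"
    and "{avg_degree W F | W F. subgraph W F V E \<and> W \<noteq> {}} \<noteq> {}"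
proof -
  have "{avg_degree W F | W F. subgraph W F V E \<and> W \<noteq> {}}
      \<subseteq> (\<lambda>(W, F). avg_degree W F) ` (Pow V \<times> Pow E)"
    by (auto simp: subgraph_def)
  then show "finite {avg_degree W F | W F. subgraph W F V E \<and> W \<noteq> {}}"
    by (rule finite_subset) (simp add: finite_verts finite_edges)
  have "subgraph V E V E"
    by (simp add: subgraph_def fin_sgraph_axioms)
  with assms show "{avg_degree W F | W F. subgraph W F V E \<and> W \<noteq> {}} \<noteq> {}"
    by blast
qed


subsection \<open>Weak degeneracy\<close>

definition del_edges :: "'a set set \<Rightarrow> 'a \<Rightarrow> 'a set set" where
  "del_edges E u = {e \<in> E. u \<notin> e}"

text \<open>The functions \<open>f'\<close> output by Delete and DelSave. They are total functions on the vertex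
  type; only their values on the remaining vertices matter.\<close>

definition delete_fun :: "'a set set \<Rightarrow> ('a \<Rightarrow> int) \<Rightarrow> 'a \<Rightarrow> 'a \<Rightarrow> int" where
  "delete_fun E f u = (\<lambda>v. if {u, v} \<in> E then f v - 1 else f v)"

definition delsave_fun :: "'a set set \<Rightarrow> ('a \<Rightarrow> int) \<Rightarrow> 'a \<Rightarrow> 'a \<Rightarrow> 'a \<Rightarrow> int" where
  "delsave_fun E f u w = (\<lambda>v. if {u, v} \<in> E \<and> v \<noteq> w then f v - 1 else f v)"

inductive legal_op ::
  "'a set \<times> 'a set set \<times> ('a \<Rightarrow> int) \<Rightarrow> 'a set \<times> 'a set set \<times> ('a \<Rightarrow> int) \<Rightarrow> bool" where
  Delete: "u \<in> V \<Longrightarrow> (\<forall>v\<in>V - {u}. delete_fun E f u v \<ge> 0) \<Longrightarrow>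
    legal_op (V, E, f) (V - {u}, del_edges E u, delete_fun E f u)"
| DelSave: "u \<in> V \<Longrightarrow> w \<in> V \<Longrightarrow> {u, w} \<in> E \<Longrightarrow> f u > f w \<Longrightarrow>
    (\<forall>v\<in>V - {u}. delsave_fun E f u w v \<ge> 0) \<Longrightarrow>
    legal_op (V, E, f) (V - {u}, del_edges E u, delsave_fun E f u w)"

definition weakly_f_degenerate :: "'a set \<Rightarrow> 'a set set \<Rightarrow> ('a \<Rightarrow> nat) \<Rightarrow> bool" where
  "weakly_f_degenerate V E f \<longleftrightarrow>
    (\<exists>f'. legal_op\<^sup>*\<^sup>* (V, E, \<lambda>v. int (f v)) ({}, {}, f'))"

definition weakly_degenerate :: "'a set \<Rightarrow> 'a set set \<Rightarrow> nat \<Rightarrow> bool" where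
  "weakly_degenerate V E d \<longleftrightarrow> weakly_f_degenerate V E (\<lambda>_. d)"

definition weak_degeneracy :: "'a set \<Rightarrow> 'a set set \<Rightarrow> nat" where
  "weak_degeneracy V E = (LEAST d. weakly_degenerate V E d)"

text \<open>The minimum exists: every finite graph is weakly \<open>d\<close>-degenerate for some \<open>d\<close>.\<close>

lemma fin_sgraph_del: "fin_sgraph V E \<Longrightarrow> fin_sgraph (V - {u}) (del_edges E u)"
  by (auto simp: fin_sgraph_def del_edges_def)

lemma delete_all:
  assumes "fin_sgraph V E" and "\<forall>v\<in>V. f v \<ge> int (card V)"
  shows "\<exists>f'. legal_op\<^sup>*\<^sup>* (V, E, f) ({}, {}, f')"
  using assms
proof (induction "card V" arbitrary: V E f)
  case 0
  then have "V = {}" "E = {}"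
    by (force simp: fin_sgraph_def)+
  then show ?case by blast
next
  case (Suc n)
  then obtain u where u: "u \<in> V"
    by fastforce
  have fin: "finite V"
    using Suc.prems(1) by (simp add: fin_sgraph_def)
  have c: "card (V - {u}) = n"
    using Suc.hyps(2) u fin by simp
  have ge: "\<forall>v\<in>V - {u}. delete_fun E f u v \<ge> int (card (V - {u}))"
  proof
    fix v assume "v \<in> V - {u}"
    then have "f v \<ge> int (card V)"
      using Suc.prems(2) by blast
    then have "f v \<ge> int n + 1"
      using Suc.hyps(2) by linarith
    then show "delete_fun E f u v \<ge> int (card (V - {u}))"
      unfolding c by (simp add: delete_fun_def)
  qed
  then have "legal_op (V, E, f) (V - {u}, del_edges E u, delete_fun E f u)"
    by (intro legal_op.Delete u) force
  moreover obtain f' where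
    "legal_op\<^sup>*\<^sup>* (V - {u}, del_edges E u, delete_fun E f u) ({}, {}, f')"
    using Suc.hyps(1)[OF c[symmetric] fin_sgraph_del[OF Suc.prems(1)] ge] by blast
  ultimately show ?case
    by (meson converse_rtranclp_into_rtranclp)
qed

lemma weakly_degenerate_weak_degeneracy:
  assumes "fin_sgraph V E"
  shows "weakly_degenerate V E (weak_degeneracy V E)"
proof -
  have "weakly_degenerate V E (card V)"
    unfolding weakly_degenerate_def weakly_f_degenerate_def
    using assms by (intro delete_all) auto
  then show ?thesis
    unfolding weak_degeneracy_def by (rule LeastI)
qed

end

theory Submission
  imports Defs
begin

text \<open>
  Choose a vertex set \<open>W\<close> minimal such that the induced subgraph \<open>G[W]\<close> is not weakly
  \<open>(d - 1)\<close>-degenerate; the average degree of \<open>G[W]\<close> is bounded from below, in the manner of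
  Gallai's bound for colour-critical graphs.  If a proper part \<open>W - S\<close> is removed first, which
  minimality permits, a vertex \<open>v\<close> of \<open>S\<close> loses at most its number of neighbours in \<open>W - S\<close>
  (\<open>removable_Un\<close>).  Hence every degree in \<open>G[W]\<close> is at least \<open>d\<close>, and for any set \<open>T\<close> of
  vertices of degree exactly \<open>d\<close>, the graph \<open>G[T]\<close> cannot be removed when each vertex starts
  with its degree in \<open>T\<close> minus one, unless \<open>T\<close> has isolated vertices.  So the set \<open>L\<close> of vertices
  of degree \<open>d\<close> is hereditarily bad.

  In a connected graph whose values are at least degree minus one, a single vertex with value at
  least its degree makes greedy removal towards that vertex succeed (\<open>removable_with_surplus\<close>).
  One application of DelSave creates such a vertex as soon as a non-cut vertex \<open>u\<close> has a
  neighbour of smaller degree.  Bad graphs therefore satisfy \<open>deg u \<le> deg w\<close> for every non-cut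
  vertex \<open>u\<close> and neighbour \<open>w\<close>, and a hereditarily bad graph has regular blocks
  (\<open>two_connected_bad_regular\<close>).  Classically one goes on to show that the blocks are complete
  graphs or cycles, but regularity is enough for counting: peeling off end blocks one at a time
  gives \<open>(d - 1 + 2/d) |S| - 2 e(S) \<ge> 2\<close> for every nonempty hereditarily bad \<open>S\<close> of maximum
  degree at most \<open>d\<close> in a graph without \<open>(d + 1)\<close>-cliques (\<open>gallai_bound\<close>).  The constant \<open>2\<close>
  matters: applied to a \<open>d\<close>-regular block minus a vertex it forces the block to have at most
  \<open>d + 1\<close> vertices, which makes it a clique and takes the place of a Brooks-type argument.

  Thus \<open>L\<close> spans few edges, so many edges leave \<open>L\<close>, and these have to be absorbed by the
  vertices of degree at least \<open>d + 1\<close>.  Comparing the two counts gives the average degree bound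
  (\<open>minimal_subset_degree_bound\<close>).
\<close>

section \<open>Degrees inside vertex sets\<close>

context fin_sgraph
begin

definition induced_edges :: "'a set \<Rightarrow> 'a set set" where
  "induced_edges W = {e \<in> E. e \<subseteq> W}"

definition deg :: "'a set \<Rightarrow> 'a \<Rightarrow> int" where
  "deg S v = int (card {w \<in> S. {v, w} \<in> E})"

definition degree_sum :: "'a set \<Rightarrow> int" where
  "degree_sum S = (\<Sum>v\<in>S. deg S v)"

lemma no_loop: "{v, v} \<notin> E" "{v} \<notin> E"
  using edge_card by force+

lemma deg_nonneg: "0 \<le> deg S v"
  by (simp add: deg_def)

lemma deg_empty [simp]: "deg {} v = 0"
  by (simp add: deg_def)

lemma deg_eq_0: "(\<And>w. w \<in> S \<Longrightarrow> {v, w} \<notin> E) \<Longrightarrow> deg S v = 0"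
  unfolding deg_def by (metis (no_types, lifting) Collect_empty_eq card.empty of_nat_0)

lemma deg_sum_indicator:
  "finite S \<Longrightarrow> deg S v = (\<Sum>w\<in>S. if {v, w} \<in> E then 1 else 0)"
  by (simp add: deg_def sum.If_cases Int_def)

lemma deg_split:
  assumes "finite S" "X \<subseteq> S"
  shows "deg S v = deg X v + deg (S - X) v"
  using assms by (simp add: deg_sum_indicator finite_subset sum.subset_diff)

lemma deg_mono: "finite S \<Longrightarrow> X \<subseteq> S \<Longrightarrow> deg X v \<le> deg S v"
  using deg_split deg_nonneg by (metis le_add_same_cancel1)

lemma deg_remove:
  assumes "finite S" "u \<in> S"
  shows "deg (S - {u}) v = deg S v - (if {u, v} \<in> E then 1 else 0)"
  using assms by (simp add: deg_sum_indicator sum.remove insert_commute)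

lemma deg_insert:
  assumes "finite S" "u \<notin> S"
  shows "deg (insert u S) v = deg S v + (if {u, v} \<in> E then 1 else 0)"
  using assms by (simp add: deg_sum_indicator insert_commute)

lemma deg_remove_self: "deg (S - {v}) v = deg S v"
proof -
  have "{w \<in> S - {v}. {v, w} \<in> E} = {w \<in> S. {v, w} \<in> E}"
    using no_loop by auto
  then show ?thesis by (simp add: deg_def)
qed

lemma deg_ge_1:
  assumes "finite S" "w \<in> S" "{v, w} \<in> E"
  shows "1 \<le> deg S v"
proof -
  have "{w \<in> S. {v, w} \<in> E} \<noteq> {}" "finite {w \<in> S. {v, w} \<in> E}"
    using assms by auto
  then have "0 < card {w \<in> S. {v, w} \<in> E}"
    by (simp add: card_gt_0_iff)
  then show ?thesis
    unfolding deg_def by linarith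
qed

lemma deg_le_card:
  assumes "finite S" "v \<in> S"
  shows "deg S v \<le> int (card S) - 1"
proof -
  have "deg S v = deg (S - {v}) v" by (simp add: deg_remove_self)
  also have "\<dots> \<le> int (card (S - {v}))"
    unfolding deg_def using assms by (intro of_nat_mono card_mono) auto
  also have "\<dots> = int (card S) - 1"
    using assms card_gt_0_iff[of S] by (auto simp: card_Diff_singleton)
  finally show ?thesis .
qed

lemma clique_of_full_degree:
  assumes "finite K" "K \<subseteq> V" "\<And>v. v \<in> K \<Longrightarrow> deg K v = int (card K) - 1"
  shows "clique V E K"
  unfolding clique_def
proof (intro conjI ballI impI)
  show "K \<subseteq> V" by fact
next
  fix x y assume xy: "x \<in> K" "y \<in> K" "x \<noteq> y"
  have sub: "{w \<in> K. {x, w} \<in> E} \<subseteq> K - {x}" using no_loop by auto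
  have "int (card {w \<in> K. {x, w} \<in> E}) = int (card K) - 1"
    using assms(3)[OF xy(1)] by (simp add: deg_def)
  also have "\<dots> = int (card (K - {x}))"
    using assms(1) xy(1) card_gt_0_iff[of K] by (auto simp: card_Diff_singleton)
  finally have "{w \<in> K. {x, w} \<in> E} = K - {x}"
    using sub assms(1) by (intro card_subset_eq) auto
  then show "{x, y} \<in> E" using xy by blast
qed

lemma sum_deg_swap:
  assumes "finite A" "finite B"
  shows "(\<Sum>a\<in>A. deg B a) = (\<Sum>b\<in>B. deg A b)"
  using sum.swap[of "\<lambda>a b. if {a, b} \<in> E then 1 else (0::int)" B A] assms
  by (simp add: deg_sum_indicator insert_commute)

lemma degree_sum_split:
  assumes "finite S" "X \<subseteq> S"
  shows "degree_sum S = (\<Sum>x\<in>X. deg S x) + degree_sum (S - X) + (\<Sum>v\<in>S - X. deg X v)"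
proof -
  have "degree_sum S = (\<Sum>x\<in>X. deg S x) + (\<Sum>x\<in>S - X. deg S x)"
    unfolding degree_sum_def using assms by (simp add: sum.subset_diff)
  also have "(\<Sum>x\<in>S - X. deg S x) = (\<Sum>x\<in>S - X. deg (S - X) x + deg X x)"
    using assms by (intro sum.cong) (simp_all add: deg_split[of S X])
  finally show ?thesis by (simp add: degree_sum_def sum.distrib)
qed

lemma handshake:
  assumes "W \<subseteq> V"
  shows "degree_sum W = 2 * int (card (induced_edges W))"
proof -
  have finW: "finite W" using assms finite_verts finite_subset by blast
  have finE: "finite (induced_edges W)"
    using finite_edges by (simp add: induced_edges_def)
  have "deg W v = (\<Sum>e\<in>induced_edges W. if v \<in> e then 1 else 0)" if v: "v \<in> W" for v
  proof -
    have "bij_betw (\<lambda>w. {v, w}) {w \<in> W. {v, w} \<in> E} {e \<in> induced_edges W. v \<in> e}"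
    proof (rule bij_betw_imageI)
      show "inj_on (\<lambda>w. {v, w}) {w \<in> W. {v, w} \<in> E}"
        by (auto simp: inj_on_def doubleton_eq_iff)
      show "(\<lambda>w. {v, w}) ` {w \<in> W. {v, w} \<in> E} = {e \<in> induced_edges W. v \<in> e}"
      proof (intro equalityI subsetI)
        fix e assume "e \<in> {e \<in> induced_edges W. v \<in> e}"
        then have e: "e \<in> E" "e \<subseteq> W" "v \<in> e" by (auto simp: induced_edges_def)
        then obtain w where "e = {v, w}"
          using edge_card[OF e(1)] by (auto simp: card_2_iff)
        then show "e \<in> (\<lambda>w. {v, w}) ` {w \<in> W. {v, w} \<in> E}" using e by auto
      qed (use v in \<open>auto simp: induced_edges_def\<close>)
    qed
    then have "deg W v = int (card {e \<in> induced_edges W. v \<in> e})"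
      by (simp add: deg_def bij_betw_same_card)
    then show ?thesis using finE by (simp add: sum.If_cases Int_def)
  qed
  then have "degree_sum W = (\<Sum>v\<in>W. \<Sum>e\<in>induced_edges W. if v \<in> e then 1 else 0)"
    by (simp add: degree_sum_def)
  also have "\<dots> = (\<Sum>e\<in>induced_edges W. \<Sum>v\<in>W. if v \<in> e then 1 else 0)"
    by (rule sum.swap)
  also have "\<dots> = (\<Sum>e\<in>induced_edges W. 2)"
  proof (rule sum.cong)
    fix e assume "e \<in> induced_edges W"
    then have "card e = 2" "{v \<in> W. v \<in> e} = e"
      using edge_card by (auto simp: induced_edges_def)
    then show "(\<Sum>v\<in>W. if v \<in> e then 1 else 0) = (2::int)"
      using finW by (simp add: sum.If_cases Int_def)
  qed simp
  finally show ?thesis by simp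
qed

section \<open>Removing induced subgraphs\<close>

text \<open>
  Weak degeneracy of induced subgraphs as a predicate on the vertex set alone: the edge set
  \<open>E\<close> stays fixed, and \<open>f\<close> is a total function of which only the values on the current set
  matter.  As with legal operations, values are checked to be non-negative only after an
  operation, so the starting values may be negative; in particular a single vertex can be removed
  from any starting value.
\<close>

inductive removable :: "'a set \<Rightarrow> ('a \<Rightarrow> int) \<Rightarrow> bool" where
  empty: "removable {} f"
| delete: "u \<in> W \<Longrightarrow> \<forall>v\<in>W - {u}. 0 \<le> delete_fun E f u v \<Longrightarrow>
    removable (W - {u}) (delete_fun E f u) \<Longrightarrow> removable W f"
| delsave: "u \<in> W \<Longrightarrow> w \<in> W \<Longrightarrow> {u, w} \<in> E \<Longrightarrow> f w < f u \<Longrightarrow>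
    \<forall>v\<in>W - {u}. 0 \<le> delsave_fun E f u w v \<Longrightarrow>
    removable (W - {u}) (delsave_fun E f u w) \<Longrightarrow> removable W f"

lemma removable_singleton: "removable {v} f"
  by (rule removable.delete[of v]) (auto intro: removable.empty)

lemma del_induced_edges: "del_edges (induced_edges W) u = induced_edges (W - {u})"
  by (auto simp: del_edges_def induced_edges_def)

text \<open>
  The operations of \<open>removable\<close> use adjacency in \<open>E\<close>, whereas legal operations use the shrinking edge
  set.  The resulting functions differ outside the current vertex set, so the induction has to
  allow a function \<open>g\<close> that agrees with \<open>f\<close> only on that set.
\<close>

lemma removable_imp_legal_ops:
  assumes "removable W f" "\<forall>v\<in>W. g v = f v"
  shows "\<exists>f'. legal_op\<^sup>*\<^sup>* (W, induced_edges W, g) ({}, {}, f')"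
  using assms
proof (induction arbitrary: g)
  case (empty f)
  have "induced_edges {} = {}" using edge_card by (force simp: induced_edges_def)
  then show ?case by auto
next
  case (delete u W f)
  let ?g = "delete_fun (induced_edges W) g u"
  have eq: "\<forall>v\<in>W - {u}. ?g v = delete_fun E f u v"
    using delete by (auto simp: delete_fun_def induced_edges_def)
  then have "legal_op (W, induced_edges W, g) (W - {u}, induced_edges (W - {u}), ?g)"
    using legal_op.Delete[of u W "induced_edges W" g] delete by (simp add: del_induced_edges)
  then show ?case
    using delete.IH[OF eq] by (meson converse_rtranclp_into_rtranclp)
next
  case (delsave u W w f)
  let ?g = "delsave_fun (induced_edges W) g u w"
  have eq: "\<forall>v\<in>W - {u}. ?g v = delsave_fun E f u w v"
    using delsave by (auto simp: delsave_fun_def induced_edges_def)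
  moreover have "{u, w} \<in> induced_edges W"
    using delsave by (simp add: induced_edges_def)
  ultimately have "legal_op (W, induced_edges W, g) (W - {u}, induced_edges (W - {u}), ?g)"
    using legal_op.DelSave[of u W w "induced_edges W" g] delsave by (simp add: del_induced_edges)
  then show ?case
    using delsave.IH[OF eq] by (meson converse_rtranclp_into_rtranclp)
qed

text \<open>
  Larger values can destroy the condition \<open>f w < f u\<close> of a DelSave step.  When that happens, \<open>g w\<close>
  exceeds \<open>f w\<close> by at least one and a plain Delete does no worse.
\<close>

lemma removable_mono:
  assumes "removable W f" "\<forall>v\<in>W. f v \<le> g v"
  shows "removable W g"
  using assms
proof (induction arbitrary: g)
  case (empty f)
  show ?case by (rule removable.empty)
next
  case (delete u W f)
  have le: "\<forall>v\<in>W - {u}. delete_fun E f u v \<le> delete_fun E g u v"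
    using delete.prems by (auto simp: delete_fun_def)
  show ?case
  proof (rule removable.delete[OF \<open>u \<in> W\<close>])
    show "\<forall>v\<in>W - {u}. 0 \<le> delete_fun E g u v"
      using delete.hyps(2) le by (meson order_trans)
    show "removable (W - {u}) (delete_fun E g u)"
      using delete.IH le by blast
  qed
next
  case (delsave u W w f)
  show ?case
  proof (cases "g w < g u")
    case True
    have le: "\<forall>v\<in>W - {u}. delsave_fun E f u w v \<le> delsave_fun E g u w v"
      using delsave.prems by (auto simp: delsave_fun_def)
    show ?thesis
    proof (rule removable.delsave[of u W w])
      show "\<forall>v\<in>W - {u}. 0 \<le> delsave_fun E g u w v"
        using delsave.hyps(5) le by (meson order_trans)
      show "removable (W - {u}) (delsave_fun E g u w)"
        using delsave.IH le by blast
    qed (use delsave True in auto)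
  next
    case False
    \<comment> \<open>Here \<open>g w \<ge> g u \<ge> f u > f w\<close>, so \<open>w\<close> can afford to lose one unit.\<close>
    then have "f w \<le> g w - 1"
      using delsave.prems delsave.hyps by force
    then have le: "\<forall>v\<in>W - {u}. delsave_fun E f u w v \<le> delete_fun E g u v"
      using delsave.prems by (auto simp: delsave_fun_def delete_fun_def)
    show ?thesis
    proof (rule removable.delete[of u W])
      show "\<forall>v\<in>W - {u}. 0 \<le> delete_fun E g u v"
        using delsave.hyps(5) le by (meson order_trans)
      show "removable (W - {u}) (delete_fun E g u)"
        using delsave.IH le by blast
    qed (use delsave in auto)
  qed
qed

text \<open>
  The moves that remove \<open>A\<close> on its own are still legal in the presence of \<open>S\<close>: each of them costs
  \<open>v \<in> S\<close> one unit exactly when it removes a neighbour of \<open>v\<close>, because saved vertices always lie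
  in \<open>A\<close>.  So the values on \<open>S\<close> never drop below their final values \<open>f v - deg A v \<ge> 0\<close>.
\<close>

lemma removable_Un:
  assumes "removable A f" "finite A" "A \<inter> S = {}"
    and "\<forall>v\<in>S. deg A v \<le> f v"
    and "removable S (\<lambda>v. f v - deg A v)"
  shows "removable (A \<union> S) f"
  using assms
proof (induction)
  case (empty f)
  then show ?case by simp
next
  case (delete u A f)
  let ?f = "delete_fun E f u"
  have uS: "u \<notin> S" using delete by auto
  have eq: "?f v - deg (A - {u}) v = f v - deg A v" for v
    using deg_remove[of A u v] delete by (simp add: delete_fun_def)
  have le: "deg (A - {u}) v \<le> ?f v" if "v \<in> S" for v
    using eq[of v] delete.prems(3) that by fastforce
  have diff: "A \<union> S - {u} = (A - {u}) \<union> S" using uS by auto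
  show ?case
  proof (rule removable.delete[of u])
    show "\<forall>v\<in>A \<union> S - {u}. 0 \<le> ?f v"
      unfolding diff using delete.hyps(2) le deg_nonneg by (meson UnE order_trans)
    show "removable (A \<union> S - {u}) ?f"
      unfolding diff
      by (rule delete.IH) (use delete.prems le eq in auto)
  qed (use delete in auto)
next
  case (delsave u A w f)
  let ?f = "delsave_fun E f u w"
  have uS: "u \<notin> S" "w \<notin> S" using delsave by auto
  have eq: "?f v - deg (A - {u}) v = f v - deg A v" if "v \<in> S" for v
    using deg_remove[of A u v] delsave that uS by (auto simp add: delsave_fun_def)
  have le: "deg (A - {u}) v \<le> ?f v" if "v \<in> S" for v
    using eq[of v] delsave.prems(3) that by fastforce
  have diff: "A \<union> S - {u} = (A - {u}) \<union> S" using uS by auto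
  show ?case
  proof (rule removable.delsave[of u _ w])
    show "\<forall>v\<in>A \<union> S - {u}. 0 \<le> ?f v"
      unfolding diff using delsave.hyps(5) le deg_nonneg by (meson UnE order_trans)
    show "removable (A \<union> S - {u}) ?f"
      unfolding diff
    proof (rule delsave.IH)
      show "removable S (\<lambda>v. ?f v - deg (A - {u}) v)"
        using delsave.prems(4) by (rule removable_mono) (simp add: eq)
    qed (use delsave.prems le in auto)
  qed (use delsave in auto)
qed

section \<open>Connected sets and bad sets\<close>

definition connected_set :: "'a set \<Rightarrow> bool" where
  "connected_set S \<longleftrightarrow>
    (\<forall>Y\<subseteq>S. Y \<noteq> {} \<longrightarrow> Y \<noteq> S \<longrightarrow> (\<exists>y\<in>Y. \<exists>z\<in>S - Y. {y, z} \<in> E))"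

lemma connected_setD:
  assumes "connected_set S" "Y \<subseteq> S" "Y \<noteq> {}" "Y \<noteq> S"
  obtains y z where "y \<in> Y" "z \<in> S" "z \<notin> Y" "{y, z} \<in> E"
  using assms unfolding connected_set_def by blast

lemma connected_set_deg:
  assumes "connected_set S" "finite S" "v \<in> S" "w \<in> S" "v \<noteq> w"
  shows "1 \<le> deg S v"
proof -
  obtain y z where "y \<in> {v}" "z \<in> S" "{y, z} \<in> E"
    using connected_setD[of S "{v}"] assms by (metis empty_subsetI insert_not_empty insert_subset singletonD)
  then show ?thesis using deg_ge_1 assms(2) by simp
qed

text \<open>
  Remove the vertices towards \<open>v\<close>, so that every vertex other than \<open>v\<close> still has a neighbour
  left when it is removed.  Read backwards, this order grows a set \<open>A\<close> from \<open>{v}\<close> by adding one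
  adjacent vertex \<open>z\<close> at a time; a maximal such \<open>A\<close> is all of \<open>S\<close> by connectedness.
\<close>

lemma removable_with_surplus:
  assumes conn: "connected_set S" and fin: "finite S" and v: "v \<in> S"
    and low: "\<forall>w\<in>S. deg S w - 1 \<le> f w" and surplus: "deg S v \<le> f v"
  shows "removable S f"
proof -
  define good where "good A \<longleftrightarrow> A \<subseteq> S \<and> v \<in> A \<and> (\<forall>w\<in>A - {v}. 1 \<le> deg A w) \<and>
    (\<forall>g. (\<forall>w\<in>A. deg A w - 1 \<le> g w) \<longrightarrow> deg A v \<le> g v \<longrightarrow> removable A g)" for A
  have "good {v}" using v removable_singleton by (simp add: good_def)
  moreover have "\<forall>A. good A \<longrightarrow> card A < Suc (card S)"
    using fin by (simp add: good_def card_mono less_Suc_eq_le)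
  ultimately obtain A where A: "good A" and max: "\<And>A'. good A' \<Longrightarrow> card A' \<le> card A"
    using ex_has_greatest_nat[of good "{v}" card "Suc (card S)"] by blast
  have AS: "A \<subseteq> S" and vA: "v \<in> A" using A by (auto simp: good_def)
  have finA: "finite A" using AS fin finite_subset by blast
  have "A = S"
  proof (rule ccontr)
    assume "A \<noteq> S"
    then obtain a z where az: "a \<in> A" "z \<in> S" "z \<notin> A" "{a, z} \<in> E"
      using connected_setD[OF conn AS] vA by blast
    have "good (insert z A)"
      unfolding good_def
    proof (intro conjI ballI allI impI)
      fix w assume w: "w \<in> insert z A - {v}"
      show "1 \<le> deg (insert z A) w"
      proof (cases "w = z")
        case True
        then show ?thesis using deg_ge_1[of "insert z A" a z] az finA by (simp add: insert_commute)
      next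
        case False
        then have "1 \<le> deg A w" using A w by (auto simp: good_def)
        also have "\<dots> \<le> deg (insert z A) w" using finA by (intro deg_mono) auto
        finally show ?thesis .
      qed
    next
      fix g assume g: "\<forall>w\<in>insert z A. deg (insert z A) w - 1 \<le> g w" "deg (insert z A) v \<le> g v"
      have low': "deg A w - 1 \<le> delete_fun E g z w" if "w \<in> A" for w
        using g(1) that az(3) finA by (auto simp: delete_fun_def deg_insert split: if_splits)
      have surplus': "deg A v \<le> delete_fun E g z v"
        using g(2) az(3) finA by (auto simp: delete_fun_def deg_insert split: if_splits)
      have nonneg: "0 \<le> delete_fun E g z w" if w: "w \<in> A" for w
      proof (cases "w = v")
        case True
        then show ?thesis using surplus' deg_nonneg order_trans by blast
      next
        case False
        then have "1 \<le> deg A w" using A w by (auto simp: good_def)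
        then show ?thesis using low'[OF w] by linarith
      qed
      have diff: "insert z A - {z} = A" using az by auto
      show "removable (insert z A) g"
      proof (rule removable.delete[of z])
        show "removable (insert z A - {z}) (delete_fun E g z)"
          unfolding diff using A low' surplus' by (simp add: good_def)
        show "\<forall>w\<in>insert z A - {z}. 0 \<le> delete_fun E g z w"
          unfolding diff using nonneg by blast
      qed simp
    qed (use AS az vA in auto)
    then have "card (insert z A) \<le> card A" by (rule max)
    then show False using az finA by simp
  qed
  then show ?thesis using A low surplus by (simp add: good_def)
qed

text \<open>
  Sets with isolated vertices are excluded: there \<open>deg T v - 1 = -1\<close> is not an admissible value,
  although \<open>removable\<close> would tolerate it as a starting value.
\<close>

definition hereditarily_bad :: "'a set \<Rightarrow> bool" where
  "hereditarily_bad S \<longleftrightarrow>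
    (\<forall>T\<subseteq>S. T \<noteq> {} \<longrightarrow> (\<forall>v\<in>T. 1 \<le> deg T v) \<longrightarrow> \<not> removable T (\<lambda>v. deg T v - 1))"

text \<open>
  If \<open>deg T w < deg T u\<close>, then deleting \<open>u\<close> while saving \<open>w\<close> leaves a connected set in which
  \<open>w\<close> has a surplus, so \<open>T\<close> could be removed.
\<close>

lemma bad_degree_le:
  assumes bad: "hereditarily_bad S" and TS: "T \<subseteq> S" and fin: "finite T"
    and u: "u \<in> T" and w: "w \<in> T" and uw: "{u, w} \<in> E"
    and conn: "connected_set (T - {u})"
  shows "deg T u \<le> deg T w"
proof (rule ccontr)
  assume "\<not> deg T u \<le> deg T w"
  then have less: "deg T w < deg T u" by simp
  have ne: "u \<noteq> w" using uw no_loop by auto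
  have pos': "1 \<le> deg (T - {u}) v" if "v \<in> T - {u}" "v \<noteq> w" for v
    using connected_set_deg[OF conn, of v w] that w ne fin by auto
  have pos: "1 \<le> deg T v" if v: "v \<in> T" for v
  proof -
    consider "v = u" | "v = w" | "v \<in> T - {u}" "v \<noteq> w" using v by blast
    then show ?thesis
    proof cases
      case 1
      then show ?thesis using deg_ge_1[OF fin w uw] by simp
    next
      case 2
      then show ?thesis using deg_ge_1[OF fin u, of w] uw by (simp add: insert_commute)
    next
      case 3
      then show ?thesis using pos'[of v] deg_mono[OF fin, of "T - {u}" v] by auto
    qed
  qed
  let ?f = "delsave_fun E (\<lambda>v. deg T v - 1) u w"
  have other: "?f v = deg (T - {u}) v - 1" if "v \<noteq> w" for v
    using that fin u by (simp add: delsave_fun_def deg_remove)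
  have saved: "?f w = deg (T - {u}) w"
    using fin u uw by (simp add: delsave_fun_def deg_remove)
  have "removable T (\<lambda>v. deg T v - 1)"
  proof (rule removable.delsave[of u T w])
    show "\<forall>v\<in>T - {u}. 0 \<le> ?f v"
      using other saved pos' deg_nonneg by (metis diff_ge_0_iff_ge)
    have "deg (T - {u}) v - 1 \<le> ?f v" for v
      using other saved by (cases "v = w") auto
    then show "removable (T - {u}) ?f"
      using removable_with_surplus[OF conn, of w] fin w ne saved by simp
  qed (use u w uw less in auto)
  then show False
    using bad TS u pos unfolding hereditarily_bad_def by blast
qed

text \<open>Without cut vertices, the inequality applies to each edge in both directions.\<close>

lemma two_connected_bad_regular:
  assumes bad: "hereditarily_bad S" and BS: "B \<subseteq> S" and fin: "finite B" and c: "c \<in> B"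
    and conn: "connected_set B" and conn': "\<And>w. w \<in> B \<Longrightarrow> connected_set (B - {w})"
    and v: "v \<in> B"
  shows "deg B v = deg B c"
proof -
  have "{x \<in> B. deg B x = deg B c} = B"
  proof (rule ccontr)
    assume "{x \<in> B. deg B x = deg B c} \<noteq> B"
    then obtain y z where yz: "y \<in> {x \<in> B. deg B x = deg B c}" "z \<in> B"
      "z \<notin> {x \<in> B. deg B x = deg B c}" "{y, z} \<in> E"
      using connected_setD[OF conn, of "{x \<in> B. deg B x = deg B c}"] c by blast
    have "deg B y \<le> deg B z" "deg B z \<le> deg B y"
      using bad_degree_le[OF bad BS fin, of y z] bad_degree_le[OF bad BS fin, of z y] conn' yz
      by (auto simp: insert_commute)
    then show False using yz by auto
  qed
  then show ?thesis using v by blast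
qed

section \<open>End blocks\<close>

definition boundary :: "'a set \<Rightarrow> 'a set \<Rightarrow> 'a set" where
  "boundary S X = {z \<in> S - X. \<exists>x\<in>X. {x, z} \<in> E}"

text \<open>
  End blocks are found without a theory of blocks.  Take a smallest nonempty \<open>X\<close> with at most
  one boundary vertex.  If it has none, removing a vertex from \<open>X\<close> would give a smaller such set,
  so \<open>X\<close> is a single isolated vertex.  If its boundary is \<open>{c}\<close>, a cut vertex of \<open>X \<union> {c}\<close>
  would separate off a proper subset of \<open>X\<close> with at most one boundary vertex.
\<close>

lemma end_block:
  assumes fin: "finite S" and ne: "S \<noteq> {}"
  obtains (isolated) v where "v \<in> S" "boundary S {v} = {}"
  | (block) X c where "X \<subseteq> S" "X \<noteq> {}" "c \<in> S - X" "boundary S X = {c}"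
      "connected_set (insert c X)"
      "\<And>w. w \<in> insert c X \<Longrightarrow> connected_set (insert c X - {w})"
proof -
  define P where "P X \<longleftrightarrow> X \<subseteq> S \<and> X \<noteq> {} \<and> card (boundary S X) \<le> 1" for X
  have "P S" using ne by (simp add: P_def boundary_def)
  then obtain X where X: "P X" and min: "\<And>Y. P Y \<Longrightarrow> card X \<le> card Y"
    by (metis ex_has_least_nat)
  have XS: "X \<subseteq> S" and Xne: "X \<noteq> {}" using X by (auto simp: P_def)
  have finX: "finite X" using XS fin finite_subset by blast
  have two: "2 \<le> card (boundary S Y)" if "Y \<subset> X" "Y \<noteq> {}" for Y
  proof (rule ccontr)
    assume "\<not> 2 \<le> card (boundary S Y)"
    then have "P Y" using that XS by (auto simp: P_def)
    then have "card X \<le> card Y" by (rule min)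
    then show False using psubset_card_mono[OF finX that(1)] by simp
  qed
  have finb: "finite (boundary S Y)" for Y using fin by (simp add: boundary_def)
  show thesis
  proof (cases "boundary S X = {}")
    case True
    obtain v where v: "v \<in> X" using Xne by blast
    have "X = {v}"
    proof (rule ccontr)
      assume "X \<noteq> {v}"
      then have "X - {v} \<noteq> {}" "X - {v} \<subset> X" using v by auto
      then have "2 \<le> card (boundary S (X - {v}))" by (intro two)
      moreover have "boundary S (X - {v}) \<subseteq> {v}" using True by (auto simp: boundary_def)
      then have "card (boundary S (X - {v})) \<le> 1"
        using card_mono[of "{v}"] by fastforce
      ultimately show False by linarith
    qed
    then show thesis using isolated[of v] True XS by auto
  next
    case False
    then have "card (boundary S X) = 1"
      using X finb[of X] by (metis P_def card_0_eq le_SucE le_zero_eq One_nat_def)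
    then obtain c where bc: "boundary S X = {c}" by (auto simp: card_1_singleton_iff)
    have c: "c \<in> S - X" using bc by (auto simp: boundary_def)
    let ?B = "insert c X"
    have nb: "z \<in> ?B" if "x \<in> X" "z \<in> S" "{x, z} \<in> E" for x z
      using that bc by (auto simp: boundary_def)
    \<comment> \<open>By minimality of \<open>X\<close>, a proper part \<open>Y\<close> has two boundary vertices, and at most one of them
      is the deleted vertex \<open>w\<close>.\<close>
    have escape: "\<exists>y\<in>Y. \<exists>z\<in>?B - Y. {y, z} \<in> E \<and> z \<noteq> w"
      if Y: "Y \<subset> X" "Y \<noteq> {}" for Y w
    proof -
      have "\<not> boundary S Y \<subseteq> {w}"
      proof
        assume "boundary S Y \<subseteq> {w}"
        then have "card (boundary S Y) \<le> 1" using card_mono[of "{w}"] by fastforce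
        then show False using two[OF Y] by linarith
      qed
      then obtain z y where "z \<in> S - Y" "y \<in> Y" "{y, z} \<in> E" "z \<noteq> w"
        by (auto simp: boundary_def)
      moreover from this have "z \<in> ?B" using Y nb by blast
      ultimately show ?thesis by blast
    qed
    have conn': "connected_set (?B - {w})" if w: "w \<in> ?B" for w
      unfolding connected_set_def
    proof (intro allI impI)
      fix Y assume Y: "Y \<subseteq> ?B - {w}" "Y \<noteq> {}" "Y \<noteq> ?B - {w}"
      show "\<exists>y\<in>Y. \<exists>z\<in>?B - {w} - Y. {y, z} \<in> E"
      proof (cases "c \<in> Y")
        case False
        then have "Y \<subset> X" using Y w c by auto
        then show ?thesis using escape[of Y w] Y by blast
      next
        case True
        \<comment> \<open>Now \<open>Y\<close> need not be a part of \<open>X\<close>, but its complement is.\<close>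
        let ?Y = "?B - {w} - Y"
        have "?Y \<noteq> {}" "?Y \<subset> X" using True Y w by auto
        then obtain y z where yz: "y \<in> ?Y" "z \<in> ?B - ?Y" "{y, z} \<in> E" "z \<noteq> w"
          using escape[of ?Y w] by blast
        then have "z \<in> Y" by blast
        then show ?thesis using yz by (metis insert_commute)
      qed
    qed
    have "connected_set ?B"
      unfolding connected_set_def
    proof (intro allI impI)
      fix Y assume Y: "Y \<subseteq> ?B" "Y \<noteq> {}" "Y \<noteq> ?B"
      have cross: "\<exists>y\<in>Z. \<exists>z\<in>?B - Z. {y, z} \<in> E" if Z: "Z \<subseteq> X" "Z \<noteq> {}" for Z
      proof (cases "Z = X")
        case True
        have "c \<in> boundary S X" using bc by simp
        then show ?thesis using True c by (auto simp: boundary_def)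
      next
        case False
        then show ?thesis using escape[of Z] Z by blast
      qed
      show "\<exists>y\<in>Y. \<exists>z\<in>?B - Y. {y, z} \<in> E"
      proof (cases "c \<in> Y")
        case False
        then show ?thesis using cross[of Y] Y by blast
      next
        case True
        then have "?B - Y \<subseteq> X" "?B - Y \<noteq> {}" using Y by auto
        then obtain y z where yz: "y \<in> ?B - Y" "z \<in> ?B - (?B - Y)" "{y, z} \<in> E"
          using cross[of "?B - Y"] by blast
        then have "z \<in> Y" by blast
        then show ?thesis using yz by (metis insert_commute)
      qed
    qed
    then show thesis using block[of X c] XS Xne c bc conn' by blast
  qed
qed

section \<open>Few edges in hereditarily bad sets\<close>

lemma deg_single: "deg {c} v = (if {v, c} \<in> E then 1 else 0)"
  by (simp add: deg_sum_indicator)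

text \<open>
  This is \<open>(d - 1 + 2/d) |S| - 2 e(S) \<ge> 2\<close> multiplied by \<open>d\<close>.  The proof is by induction on
  \<open>|S|\<close>; write \<open>p(S)\<close> for the right-hand side.  An isolated vertex contributes
  \<open>d\<^sup>2 - d + 2 \<ge> 2 d\<close> to it.  Otherwise let \<open>B\<close> be an end block attached at \<open>c\<close>, of order \<open>b\<close> and
  regular of degree \<open>r < b\<close>.  For \<open>r \<le> d - 2\<close>, removing \<open>B - c\<close> does not increase \<open>p\<close>.  For
  \<open>r = d - 1\<close>, removing only \<open>B - c\<close> could increase it, but \<open>c\<close> has at most one neighbour outside
  \<open>B\<close>, and removing all of \<open>B\<close> lowers \<open>p\<close> by at least \<open>2 b - 2 d \<ge> 0\<close>; if nothing remains, then
  \<open>p(S) = 2 b \<ge> 2 d\<close>.  For \<open>r = d\<close>, the induction hypothesis for \<open>B - c\<close> reads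
  \<open>(d - 2) b \<le> (d - 2) (d + 1)\<close>, so \<open>B\<close> would be a \<open>(d + 1)\<close>-clique.
\<close>

lemma gallai_bound:
  fixes d :: int
  assumes "S \<subseteq> V" "S \<noteq> {}" "hereditarily_bad S" and d: "3 \<le> d"
    and "\<forall>v\<in>S. deg S v \<le> d"
    and noclique: "\<nexists>K. clique V E K \<and> int (card K) = d + 1"
  shows "2 * d \<le> (d\<^sup>2 - d + 2) * int (card S) - d * degree_sum S"
  using assms(1,2,3,5)
proof (induction "card S" arbitrary: S rule: less_induct)
  case less
  define p where "p S = (d\<^sup>2 - d + 2) * int (card S) - d * degree_sum S" for S
  have finS: "finite S" using less.prems(1) finite_verts finite_subset by blast
  have IH: "2 * d \<le> p T" if T: "T \<subset> S" "T \<noteq> {}" for T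
    unfolding p_def
  proof (rule less.hyps)
    show "card T < card S" using T finS by (simp add: psubset_card_mono)
    show "hereditarily_bad T"
      using less.prems(3) T unfolding hereditarily_bad_def by (meson order_trans psubset_imp_subset)
    show "\<forall>v\<in>T. deg T v \<le> d"
      using less.prems(4) T deg_mono[OF finS, of T] by (meson order_trans psubset_imp_subset subsetD)
  qed (use T less.prems in auto)
  have dd: "d\<^sup>2 = d * d" by (simp add: power2_eq_square)
  have d3: "3 * d \<le> d * d" using d by (intro mult_right_mono) auto
  show ?case
    using finS less.prems(2)
  proof (cases rule: end_block)
    case (isolated v)
    have nadj: "{v, z} \<notin> E" if "z \<in> S" for z
      using isolated that no_loop by (auto simp: boundary_def)
    have "deg S v = 0" using nadj by (rule deg_eq_0)
    moreover have "(\<Sum>x\<in>S - {v}. deg {v} x) = 0"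
      using nadj by (intro sum.neutral) (auto simp: deg_single insert_commute)
    ultimately have D: "degree_sum S = degree_sum (S - {v})"
      using degree_sum_split[OF finS, of "{v}"] isolated by simp
    have card: "int (card S) = int (card (S - {v})) + 1"
      using card.remove[OF finS isolated(1)] by simp
    have p: "p S = p (S - {v}) + (d\<^sup>2 - d + 2)"
      by (simp add: p_def D card algebra_simps)
    have "0 \<le> p (S - {v})"
    proof (cases "S - {v} = {}")
      case True
      then show ?thesis unfolding True by (simp add: p_def degree_sum_def)
    next
      case False
      moreover have "S - {v} \<subset> S" using isolated(1) by blast
      ultimately show ?thesis using IH[of "S - {v}"] d by linarith
    qed
    then have "2 * d \<le> p S" using p d3 dd by linarith
    then show ?thesis by (simp add: p_def)
  next
    case (block X c)
    let ?B = "insert c X"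
    define r where "r = deg ?B c"
    define b where "b = int (card ?B)"
    have BS: "?B \<subseteq> S" using block by auto
    have finX: "finite X" and finB: "finite ?B" using block(1) finS finite_subset by auto
    have reg: "deg ?B v = r" if "v \<in> ?B" for v
      unfolding r_def
      using two_connected_bad_regular[OF less.prems(3) BS finB _ block(5,6) that] by simp
    have Xcard: "int (card X) = b - 1" using block finX by (simp add: b_def)
    have br: "r + 1 \<le> b" using deg_le_card[OF finB, of c] by (simp add: r_def b_def)
    have rc: "deg X c = r"
      using deg_remove_self[of ?B c] block(3) by (simp add: r_def)
    obtain x where "x \<in> X" "{x, c} \<in> E" using block(4) by (auto simp: boundary_def)
    then have r1: "1 \<le> r" unfolding rc[symmetric] using finX by (intro deg_ge_1) (auto simp: insert_commute)
    have rd: "r \<le> d"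
      unfolding r_def using deg_mono[OF finS BS, of c] less.prems(4) block by fastforce
    have out: "{x, z} \<notin> E" if "x \<in> X" "z \<in> S - ?B" for x z
      using that block(4) by (auto simp: boundary_def)
    have degX: "deg S x = r" if x: "x \<in> X" for x
    proof -
      have "deg (S - ?B) x = 0" using out[OF x] by (rule deg_eq_0)
      then show ?thesis using deg_split[OF finS BS, of x] reg x by simp
    qed
    have into_X: "deg X z = 0" if "z \<in> S - ?B" for z
      using out[OF _ that] by (intro deg_eq_0) (simp add: insert_commute)
    consider "r \<le> d - 2" | "r = d - 1" | "r = d" using rd by linarith
    then have "2 * d \<le> p S"
    proof cases
      case 1
      have "(\<Sum>v\<in>S - X. deg X v) = deg X c + (\<Sum>v\<in>S - X - {c}. deg X v)"
        using finS block by (intro sum.remove) auto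
      also have "(\<Sum>v\<in>S - X - {c}. deg X v) = 0"
        using into_X by (intro sum.neutral) auto
      finally have D: "degree_sum S = r * (b - 1) + degree_sum (S - X) + r"
        using degree_sum_split[OF finS block(1)] degX rc Xcard by simp
      have C: "int (card S) = int (card (S - X)) + (b - 1)"
        using card_Diff_subset[OF finX block(1)] card_mono[OF finS block(1)] Xcard by simp
      have p: "p S = p (S - X) + ((d\<^sup>2 - d + 2) * (b - 1) - d * r * b)"
        unfolding p_def D C by (simp add: algebra_simps)
      have nn: "0 \<le> d * (d - 2 - r)" using d 1 by simp
      then have "0 \<le> d\<^sup>2 - d + 2 - d * r" using d by (simp add: dd algebra_simps)
      then have "(d\<^sup>2 - d + 2 - d * r) * (r + 1) \<le> (d\<^sup>2 - d + 2 - d * r) * b"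
        using br by (intro mult_left_mono) auto
      moreover have "0 \<le> r * (d * (d - 2 - r) + 2)" using nn r1 by simp
      ultimately have "0 \<le> (d\<^sup>2 - d + 2) * (b - 1) - d * r * b"
        by (simp add: dd algebra_simps)
      moreover have "2 * d \<le> p (S - X)" using IH[of "S - X"] block by auto
      ultimately show ?thesis using p by linarith
    next
      case 2
      define s where "s = deg (S - ?B) c"
      have Sc: "deg S c = r + s"
        using deg_split[OF finS BS, of c] by (simp add: r_def s_def)
      then have s1: "s \<le> 1" using less.prems(4) block(3) 2 by fastforce
      have "(\<Sum>v\<in>S - ?B. deg ?B v) = (\<Sum>v\<in>?B. deg (S - ?B) v)"
        using finS finB by (intro sum_deg_swap) auto
      also have "\<dots> = s + (\<Sum>v\<in>X. deg (S - ?B) v)"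
        using finX block(3) by (simp add: s_def)
      also have "(\<Sum>v\<in>X. deg (S - ?B) v) = 0"
        using out by (intro sum.neutral ballI deg_eq_0)
      finally have D: "degree_sum S = (r + s) + r * (b - 1) + degree_sum (S - ?B) + s"
        using degree_sum_split[OF finS BS] degX Sc Xcard finX block(3) by simp
      have C: "int (card S) = int (card (S - ?B)) + b"
        using card_Diff_subset[OF finB BS] card_mono[OF finS BS] by (simp add: b_def)
      have p: "p S = p (S - ?B) + (2 * b - 2 * (d * s))"
        unfolding p_def D C by (simp add: 2 dd algebra_simps)
      have ds: "d * s \<le> d * 1" using s1 d by (intro mult_left_mono) auto
      show ?thesis
      proof (cases "S - ?B = {}")
        case True
        have "s = 0" unfolding s_def True by simp
        then show ?thesis using p br 2 unfolding True by (simp add: p_def degree_sum_def)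
      next
        case False
        then have "2 * d \<le> p (S - ?B)" using IH[of "S - ?B"] block by auto
        then show ?thesis using p ds br 2 by linarith
      qed
    next
      case 3
      have "(\<Sum>v\<in>X. deg {c} v) = deg X c"
        using sum_deg_swap[OF finX, of "{c}"] by simp
      moreover have "?B - {c} = X" using block by auto
      ultimately have "degree_sum ?B = d + degree_sum X + d"
        using degree_sum_split[OF finB, of "{c}"] rc reg[of c] 3 by simp
      moreover have "degree_sum ?B = d * b"
        unfolding degree_sum_def using reg 3 by (simp add: b_def del: card_insert_disjoint)
      ultimately have DX: "degree_sum X = d * b - 2 * d" by linarith
      have "2 * d \<le> p X" using IH[of X] block by auto
      then have "(d - 2) * b \<le> (d - 2) * (d + 1)"
        by (simp add: p_def DX Xcard dd algebra_simps)
      then have "b \<le> d + 1" using d by (simp add: mult_le_cancel_left)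
      then have b: "b = d + 1" using br 3 by simp
      have "clique V E ?B"
        by (rule clique_of_full_degree) (use finB BS less.prems(1) reg 3 b in \<open>auto simp: b_def\<close>)
      then show ?thesis using noclique b by (auto simp: b_def)
    qed
    then show ?thesis by (simp add: p_def)
  qed
qed

section \<open>Average degree of a minimal obstruction\<close>

text \<open>
  Let \<open>n = |W|\<close>, let \<open>l\<close> be the number of vertices of degree \<open>d\<close>, and let \<open>D\<close> be the degree sum.
  Since the other vertices have degree at least \<open>d + 1\<close>, one gets \<open>D \<ge> (d + 1) n - l\<close>.  By
  Gallai's bound at least \<open>(1 - 2/d) l\<close> edges leave \<open>L\<close>, so the other vertices have degree sum
  \<open>D - d l \<ge> (1 - 2/d) l\<close>.  Eliminating \<open>l\<close> from the two inequalities gives the claim.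
\<close>

lemma minimal_subset_degree_bound:
  fixes d :: int
  assumes WV: "W \<subseteq> V" and d: "3 \<le> d"
    and notrem: "\<not> removable W (\<lambda>_. d - 1)"
    and min: "\<And>A. A \<subset> W \<Longrightarrow> removable A (\<lambda>_. d - 1)"
    and noclique: "\<nexists>K. clique V E K \<and> int (card K) = d + 1"
  shows "(d\<^sup>2 + d - 2) * (d + 1) * int (card W) \<le> (d\<^sup>2 + 2 * d - 2) * degree_sum W"
proof -
  have finW: "finite W" using WV finite_verts finite_subset by blast
  \<comment> \<open>Removing \<open>W - S\<close> first is possible by minimality, so what is left must get stuck.\<close>
  have ext: "\<not> removable S (\<lambda>v. d - 1 - deg (W - S) v)"
    if S: "S \<subseteq> W" "S \<noteq> {}" "\<forall>v\<in>S. deg (W - S) v \<le> d - 1" for S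
  proof
    assume "removable S (\<lambda>v. d - 1 - deg (W - S) v)"
    moreover have "removable (W - S) (\<lambda>_. d - 1)" using S by (intro min) auto
    ultimately have "removable ((W - S) \<union> S) (\<lambda>_. d - 1)"
      using S finW by (intro removable_Un) auto
    then show False using notrem S(1) by (simp add: Un_absorb2)
  qed
  have mindeg: "d \<le> deg W v" if v: "v \<in> W" for v
  proof (rule ccontr)
    assume "\<not> d \<le> deg W v"
    then show False using ext[of "{v}"] v removable_singleton by (simp add: deg_remove_self)
  qed
  define L where "L = {v \<in> W. deg W v = d}"
  have LW: "L \<subseteq> W" by (auto simp: L_def)
  have finL: "finite L" using LW finW finite_subset by blast
  have bad: "hereditarily_bad L"
    unfolding hereditarily_bad_def
  proof (intro allI impI)
    fix T assume T: "T \<subseteq> L" "T \<noteq> {}" "\<forall>v\<in>T. 1 \<le> deg T v"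
    have TW: "T \<subseteq> W" using T LW by auto
    have eq: "deg (W - T) v = d - deg T v" if "v \<in> T" for v
      using deg_split[OF finW TW, of v] that T by (auto simp: L_def)
    have "\<not> removable T (\<lambda>v. d - 1 - deg (W - T) v)"
      using T TW eq by (intro ext) auto
    then show "\<not> removable T (\<lambda>v. deg T v - 1)"
      using removable_mono[of T "\<lambda>v. deg T v - 1" "\<lambda>v. d - 1 - deg (W - T) v"] eq by auto
  qed
  have gallai: "0 \<le> (d\<^sup>2 - d + 2) * int (card L) - d * degree_sum L"
  proof (cases "L = {}")
    case True
    then show ?thesis by (simp add: degree_sum_def)
  next
    case False
    have "\<forall>v\<in>L. deg L v \<le> d"
      using deg_mono[OF finW LW] by (auto simp: L_def)
    then show ?thesis
      using gallai_bound[OF _ False bad d _ noclique] LW WV d by fastforce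
  qed
  have sumL: "(\<Sum>v\<in>L. deg W v) = d * int (card L)"
    by (simp add: L_def)
  have "degree_sum W = (\<Sum>v\<in>W - L. deg W v) + (\<Sum>v\<in>L. deg W v)"
    unfolding degree_sum_def using finW LW by (rule sum.subset_diff[rotated])
  then have total: "degree_sum W = (\<Sum>v\<in>W - L. deg W v) + d * int (card L)"
    by (simp add: sumL)
  have "(\<Sum>v\<in>W - L. d + 1) \<le> (\<Sum>v\<in>W - L. deg W v)"
    using mindeg by (intro sum_mono) (force simp: L_def)
  moreover have "int (card (W - L)) = int (card W) - int (card L)"
    using card_Diff_subset[OF finL LW] card_mono[OF finW LW] by simp
  ultimately have high: "(d + 1) * (int (card W) - int (card L)) \<le> (\<Sum>v\<in>W - L. deg W v)"
    by (simp add: mult.commute)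
  have "(\<Sum>v\<in>L. deg W v) = degree_sum L + (\<Sum>v\<in>L. deg (W - L) v)"
    unfolding degree_sum_def sum.distrib[symmetric]
    using deg_split[OF finW LW] by simp
  moreover have "(\<Sum>v\<in>L. deg (W - L) v) = (\<Sum>v\<in>W - L. deg L v)"
    using finL finW by (intro sum_deg_swap) auto
  moreover have "(\<Sum>v\<in>W - L. deg L v) \<le> (\<Sum>v\<in>W - L. deg W v)"
    using deg_mono[OF finW LW] by (intro sum_mono)
  ultimately have cross: "d * int (card L) - degree_sum L \<le> (\<Sum>v\<in>W - L. deg W v)"
    using sumL by linarith
  define n l D where "n = int (card W)" and "l = int (card L)" and "D = degree_sum W"
  have "0 \<le> d\<^sup>2 + d - 2"
    using d zero_le_power2[of d] by linarith
  moreover have "(d + 1) * n \<le> D + l"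
    using high total by (simp add: n_def l_def D_def algebra_simps)
  ultimately have 1: "(d\<^sup>2 + d - 2) * ((d + 1) * n) \<le> (d\<^sup>2 + d - 2) * (D + l)"
    by (intro mult_left_mono)
  have "d * (d * l - degree_sum L) \<le> d * (D - d * l)"
    using cross total d by (intro mult_left_mono) (auto simp: l_def D_def)
  then have 2: "(d\<^sup>2 + d - 2) * l \<le> d * D"
    using gallai by (simp add: l_def power2_eq_square algebra_simps)
  have "(d\<^sup>2 + d - 2) * (d + 1) * n \<le> (d\<^sup>2 + d - 2) * D + (d\<^sup>2 + d - 2) * l"
    using 1 by (simp add: algebra_simps)
  also have "\<dots> \<le> (d\<^sup>2 + 2 * d - 2) * D"
    using 2 by (simp add: algebra_simps)
  finally show ?thesis by (simp add: n_def D_def)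
qed

end

theorem theorem1p7:
  fixes V :: "'a set" and E :: "'a set set" and d :: nat
  assumes "fin_sgraph V E"
    and "V \<noteq> {}"
    and "d \<ge> 3"
    and "weak_degeneracy V E \<ge> d"
  shows "(\<exists>K. clique V E K \<and> card K = d + 1) \<or>
    mad V E \<ge> real d + (real d - 2) / (real d ^ 2 + 2 * real d - 2)"
proof (cases "\<exists>K. clique V E K \<and> card K = d + 1")
  case False
  interpret fin_sgraph V E by fact
  have noclique: "\<nexists>K. clique V E K \<and> int (card K) = int d + 1"
    using False by auto
  have "induced_edges V = E"
    using edge_subset by (auto simp: induced_edges_def)
  moreover have "\<not> weakly_degenerate V E (d - 1)"
    using not_less_Least[of "d - 1" "weakly_degenerate V E"] assms(3,4)
    by (auto simp: weak_degeneracy_def)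
  ultimately have "\<not> removable V (\<lambda>_. int d - 1)"
    using removable_imp_legal_ops[of V "\<lambda>_. int d - 1" "\<lambda>_. int (d - 1)"] assms(3)
    by (auto simp: weakly_degenerate_def weakly_f_degenerate_def)
  then have "V \<subseteq> V \<and> \<not> removable V (\<lambda>_. int d - 1)" by simp
  then obtain W where W: "W \<subseteq> V" "\<not> removable W (\<lambda>_. int d - 1)"
    and least: "\<And>A. A \<subseteq> V \<Longrightarrow> \<not> removable A (\<lambda>_. int d - 1) \<Longrightarrow> card W \<le> card A"
    using ex_has_least_nat[of "\<lambda>A. A \<subseteq> V \<and> \<not> removable A (\<lambda>_. int d - 1)" V card] by metis
  have finW: "finite W" using W(1) finite_verts finite_subset by blast
  have Wne: "W \<noteq> {}" using W(2) removable.empty by auto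
  have min: "removable A (\<lambda>_. int d - 1)" if "A \<subset> W" for A
    using least[of A] psubset_card_mono[OF finW that] that W(1) by fastforce
  have "(int d ^ 2 + int d - 2) * (int d + 1) * int (card W)
      \<le> (int d ^ 2 + 2 * int d - 2) * (2 * int (card (induced_edges W)))"
    using minimal_subset_degree_bound[OF W(1) _ W(2) min noclique] assms(3) handshake[OF W(1)]
    by simp
  then have "real_of_int ((int d ^ 2 + int d - 2) * (int d + 1) * int (card W))
      \<le> real_of_int ((int d ^ 2 + 2 * int d - 2) * (2 * int (card (induced_edges W))))"
    by (simp only: of_int_le_iff)
  then have bound: "(real d ^ 2 + real d - 2) * (real d + 1) * real (card W)
      \<le> (real d ^ 2 + 2 * real d - 2) * (2 * real (card (induced_edges W)))"
    by simp
  have pos: "0 < real d ^ 2 + 2 * real d - 2"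
    using assms(3) zero_le_power2[of "real d"] by linarith
  have cardpos: "0 < real (card W)"
    using finW Wne by (simp add: card_gt_0_iff)
  have "real d + (real d - 2) / (real d ^ 2 + 2 * real d - 2)
      = (real d ^ 2 + real d - 2) * (real d + 1) / (real d ^ 2 + 2 * real d - 2)"
    using pos by (simp add: field_simps power2_eq_square)
  also have "\<dots> \<le> avg_degree W (induced_edges W)"
    unfolding avg_degree_def using bound pos cardpos by (simp add: divide_simps mult.commute)
  also have "\<dots> \<le> mad V E"
    unfolding mad_def
  proof (rule Max_ge[OF mad_well_defined(1)[OF assms(2)]])
    have "subgraph W (induced_edges W) V E"
      using W(1) finW edge_card by (auto simp: subgraph_def induced_edges_def fin_sgraph_def)
    then show "avg_degree W (induced_edges W)
        \<in> {avg_degree W F |W F. subgraph W F V E \<and> W \<noteq> {}}"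
      using Wne by blast
  qed
  finally show ?thesis by simp
qed simp

end
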